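(* Let $(\alpha_i)_{i\ge 1}$ be fixed real numbers with $\alpha_i\ge 0$, and let $p_i=n^{-\alpha_i}$. For integers $k\ge 0$ put $S_2^k=\sum_{i=1}^{k}\binom{k+2}{i+1}\alpha_i$. Let $d$ be the smallest non-negative integer such that $S_2^d>d+2$ (assuming such an integer exists). Then the random simplicial complex $\underline{X}(n;p_1,p_2,\ldots)$ asymptotically almost surely (as $n\to\infty$) collapses onto dimension $d-1$.
   Context: Lower multiparametric model: $\underline{X}(n;p_1,p_2,\ldots)$ is the random simplicial complex on $n$ vertices (all vertices are present) built as follows. For every $i\ge 1$, each of the $\binom{n}{i+1}$ subsets of $[n]$ of size $i+1$ is chosen independently with probability $p_i$, giving a random hypergraph $H$; then $\underline{X}$ is the maximal simplicial complex contained in $H$, i.e. a set $\sigma$ is a face iff all its subsets of size at least $2$ are chosen. Equivalently, each edge is included independently with probability $p_1$, each triangle whose boundary is present is filled independently with probability $p_2$, and so on. A property holds asymptotically almost surely (a.a.s.) if its probability tends to $1$ as $n\to\infty$. Collapses: in a simplicial complex $C$, let $\sigma\subset\tau$ be faces with $\sigma$ a codimension-one face of $\tau$ such that no simplex other than $\tau$ properly contains $\sigma$ (then $\sigma$ is called a free face). Erasing both $\sigma$ and $\tau$ is an elementary collapse. $C$ collapses onto dimension $d$ if there is a finite (possibly empty) sequence of elementary collapses starting with $C$ and resulting in a simplicial complex all of whose simplices have dimension at most $d$. *)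

theory Defs
  imports "HOL-Probability.Probability"
begin

text \<open>
  A simplicial complex is represented by its set of nonempty faces. In particular the empty
  simplex takes no part in collapses.
\<close>

definition lower_complex :: "nat \<Rightarrow> nat set set \<Rightarrow> nat set set" where
  "lower_complex n H =
     {\<sigma>. \<sigma> \<noteq> {} \<and> \<sigma> \<subseteq> {1..n} \<and> (\<forall>\<tau>\<subseteq>\<sigma>. card \<tau> \<ge> 2 \<longrightarrow> \<tau> \<in> H)}"

definition hyperedges :: "nat \<Rightarrow> nat set set" where
  "hyperedges n = {\<sigma>. \<sigma> \<subseteq> {1..n} \<and> card \<sigma> \<ge> 2}"

text \<open>
  \<open>p i\<close> is the probability of choosing a set of size \<open>i + 1\<close>. A sample of the product
  distribution is an indicator function, which is turned into the set of chosen hyperedges.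
\<close>

definition random_hypergraph :: "nat \<Rightarrow> (nat \<Rightarrow> real) \<Rightarrow> nat set set pmf" where
  "random_hypergraph n p =
     map_pmf (\<lambda>f. {\<sigma> \<in> hyperedges n. f \<sigma>})
       (Pi_pmf (hyperedges n) False (\<lambda>\<sigma>. bernoulli_pmf (p (card \<sigma> - 1))))"

definition lower_model :: "nat \<Rightarrow> (nat \<Rightarrow> real) \<Rightarrow> nat set set pmf" where
  "lower_model n p = map_pmf (lower_complex n) (random_hypergraph n p)"

definition simplex_dim :: "'a set \<Rightarrow> int" where
  "simplex_dim \<sigma> = int (card \<sigma>) - 1"

definition free_face :: "'a set set \<Rightarrow> 'a set \<Rightarrow> 'a set \<Rightarrow> bool" where
  "free_face C \<sigma> \<tau> \<longleftrightarrow>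
     \<sigma> \<in> C \<and> \<tau> \<in> C \<and> \<sigma> \<subset> \<tau> \<and> simplex_dim \<tau> = simplex_dim \<sigma> + 1 \<and>
     (\<forall>\<rho>\<in>C. \<sigma> \<subset> \<rho> \<longrightarrow> \<rho> = \<tau>)"

definition elementary_collapse :: "'a set set \<Rightarrow> 'a set set \<Rightarrow> bool" where
  "elementary_collapse C D \<longleftrightarrow> (\<exists>\<sigma> \<tau>. free_face C \<sigma> \<tau> \<and> D = C - {\<sigma>, \<tau>})"

definition collapses_onto_dim :: "'a set set \<Rightarrow> int \<Rightarrow> bool" where
  "collapses_onto_dim C d \<longleftrightarrow>
     (\<exists>D. elementary_collapse\<^sup>*\<^sup>* C D \<and> (\<forall>\<sigma>\<in>D. simplex_dim \<sigma> \<le> d))"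

definition S2 :: "(nat \<Rightarrow> real) \<Rightarrow> nat \<Rightarrow> real" where
  "S2 \<alpha> k = (\<Sum>i=1..k. real ((k + 2) choose (i + 1)) * \<alpha> i)"

end

theory Submission
  imports Defs
begin

text \<open>
  Collapsing greedily gets stuck above dimension \<open>d - 1\<close> only on a core: a nonempty family of
  \<open>d\<close>-simplices whose \<open>(d - 1)\<close>-faces each lie in at least two members; the boundary of a
  \<open>(d + 1)\<close>-simplex is one, so this also excludes simplices of dimension above \<open>d\<close>. The link of a
  vertex in a core is a core of one dimension less, so by induction each vertex lies in at least
  \<open>(d + 1) choose i\<close> faces of dimension \<open>i\<close>, and a core on \<open>m\<close> fixed vertices occurs with
  probability at most \<open>n\<close> to the power \<open>- m S2 / (d + 2)\<close>, where \<open>S2 / (d + 2) > 1\<close>. The number of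
  families on \<open>m\<close> vertices grows too fast with \<open>m\<close> for a union bound over all cores. But a core with
  many vertices contains a family grown one vertex at a time, each new vertex multiplying the
  probability by \<open>n\<close> to the power \<open>- S1\<close> with \<open>S1 > 1\<close>, so it suffices to bound families on
  boundedly many vertices.
\<close>

section \<open>Families of simplices, their weights, and cores\<close>

text \<open>Unlike in \<open>lower_complex\<close>, the empty set counts as a face. A vertex
  \<open>v\<close> then corresponds to the empty face of its link, which starts the face counts
  below.\<close>

definition faces :: "'a set set \<Rightarrow> 'a set set" where
  "faces K = (\<Union>\<tau>\<in>K. Pow \<tau>)"

text \<open>A downward closed \<open>F\<close> is contained in the random complex with probability
  \<open>n powr (- weight \<alpha> F)\<close>.\<close>

definition weight :: "(nat \<Rightarrow> real) \<Rightarrow> 'a set set \<Rightarrow> real" where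
  "weight \<alpha> F = (\<Sum>\<sigma> | \<sigma> \<in> F \<and> card \<sigma> \<ge> 2. \<alpha> (card \<sigma> - 1))"

text \<open>The parameter is the number of vertices of a member, not its dimension, so the cores of
  \<open>d\<close>-simplices are those for \<open>Suc d\<close>. At \<open>k = 0\<close> the only
  core is \<open>{{}}\<close>, the base case of the induction on links.\<close>

definition core :: "nat \<Rightarrow> 'a set set \<Rightarrow> bool" where
  "core k K \<longleftrightarrow> K \<noteq> {} \<and> (\<forall>\<tau>\<in>K. finite \<tau> \<and> card \<tau> = k) \<and>
     (\<forall>\<tau>\<in>K. \<forall>v\<in>\<tau>. \<exists>\<tau>'\<in>K. \<tau>' \<noteq> \<tau> \<and> \<tau> - {v} \<subseteq> \<tau>')"

lemma coreD:
  assumes "core k K"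
  shows "K \<noteq> {}" "\<And>\<tau>. \<tau> \<in> K \<Longrightarrow> finite \<tau>" "\<And>\<tau>. \<tau> \<in> K \<Longrightarrow> card \<tau> = k"
    "\<And>\<tau> v. \<tau> \<in> K \<Longrightarrow> v \<in> \<tau> \<Longrightarrow> \<exists>\<tau>'\<in>K. \<tau>' \<noteq> \<tau> \<and> \<tau> - {v} \<subseteq> \<tau>'"
  using assms unfolding core_def by blast+

text \<open>Serves twice: a facet \<open>\<tau> - {v}\<close> lying in a single member is a free
  face when collapsing, and the place to leave the current vertex set when growing a family.\<close>

lemma not_coreE:
  assumes "\<not> core k K" "K \<noteq> {}" "\<And>\<tau>. \<tau> \<in> K \<Longrightarrow> finite \<tau>" "\<And>\<tau>. \<tau> \<in> K \<Longrightarrow> card \<tau> = k"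
  obtains \<tau> v where "\<tau> \<in> K" "v \<in> \<tau>" "\<And>\<tau>'. \<tau>' \<in> K \<Longrightarrow> \<tau> - {v} \<subseteq> \<tau>' \<Longrightarrow> \<tau>' = \<tau>"
proof -
  have "\<not> (\<forall>\<tau>\<in>K. \<forall>v\<in>\<tau>. \<exists>\<tau>'\<in>K. \<tau>' \<noteq> \<tau> \<and> \<tau> - {v} \<subseteq> \<tau>')"
    using assms unfolding core_def by simp
  with that show thesis by meson
qed

lemma finite_faces: "finite K \<Longrightarrow> (\<And>\<tau>. \<tau> \<in> K \<Longrightarrow> finite \<tau>) \<Longrightarrow> finite (faces K)"
  by (auto simp: faces_def)

lemma weight_eq_sum_card:
  assumes "finite F" "\<And>\<sigma>. \<sigma> \<in> F \<Longrightarrow> card \<sigma> \<le> Suc d"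
  shows "weight \<alpha> F = (\<Sum>i=1..d. \<alpha> i * real (card {\<sigma> \<in> F. card \<sigma> = Suc i}))"
proof -
  let ?S = "{\<sigma> \<in> F. card \<sigma> \<ge> 2}"
  have "weight \<alpha> F = (\<Sum>i=1..d. \<Sum>\<sigma> | \<sigma> \<in> ?S \<and> card \<sigma> - 1 = i. \<alpha> (card \<sigma> - 1))"
    unfolding weight_def
    using assms by (intro sum.group[symmetric]) (force simp: image_subset_iff)+
  also have "\<dots> = (\<Sum>i=1..d. \<Sum>\<sigma> | \<sigma> \<in> F \<and> card \<sigma> = Suc i. \<alpha> i)"
    by (intro sum.cong) auto
  also have "\<dots> = (\<Sum>i=1..d. \<alpha> i * real (card {\<sigma> \<in> F. card \<sigma> = Suc i}))"
    by (simp add: mult.commute)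
  finally show ?thesis .
qed

section \<open>Links and face numbers of cores\<close>

text \<open>A second member of \<open>K\<close> over \<open>insert v \<rho> - {u}\<close> contains
  \<open>v\<close> because \<open>u\<close> differs from \<open>v\<close>; deleting \<open>v\<close>
  from it gives the second member of the link.\<close>

lemma core_link:
  assumes "core (Suc k) K" "v \<in> \<Union>K"
  shows "core k {\<rho>. v \<notin> \<rho> \<and> insert v \<rho> \<in> K}"
  unfolding core_def
proof (intro conjI ballI)
  obtain \<tau> where "\<tau> \<in> K" "v \<in> \<tau>" using assms(2) by blast
  then have "\<tau> - {v} \<in> {\<rho>. v \<notin> \<rho> \<and> insert v \<rho> \<in> K}" by (simp add: insert_absorb)
  then show "{\<rho>. v \<notin> \<rho> \<and> insert v \<rho> \<in> K} \<noteq> {}" by (metis empty_iff)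
next
  fix \<rho> assume \<rho>: "\<rho> \<in> {\<rho>. v \<notin> \<rho> \<and> insert v \<rho> \<in> K}"
  show fin: "finite \<rho>" using coreD(2)[OF assms(1), of "insert v \<rho>"] \<rho> by simp
  show "card \<rho> = k" using coreD(3)[OF assms(1), of "insert v \<rho>"] \<rho> fin by simp
  fix u assume u: "u \<in> \<rho>"
  obtain \<tau>' where \<tau>': "\<tau>' \<in> K" "\<tau>' \<noteq> insert v \<rho>" "insert v \<rho> - {u} \<subseteq> \<tau>'"
    using coreD(4)[OF assms(1), of "insert v \<rho>" u] \<rho> u by auto
  have "v \<in> \<tau>'" using \<tau>' u \<rho> by blast
  then have "\<tau>' - {v} \<in> {\<rho>. v \<notin> \<rho> \<and> insert v \<rho> \<in> K}" "\<tau>' - {v} \<noteq> \<rho>" "\<rho> - {u} \<subseteq> \<tau>' - {v}"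
    using \<tau>' \<rho> by (auto simp: insert_absorb)
  then show "\<exists>\<tau>'\<in>{\<rho>. v \<notin> \<rho> \<and> insert v \<rho> \<in> K}. \<tau>' \<noteq> \<rho> \<and> \<rho> - {u} \<subseteq> \<tau>'"
    by (intro bexI[of _ "\<tau>' - {v}"] conjI)
qed

text \<open>Deleting \<open>v\<close> and inserting it again are mutually inverse. Finiteness is
  part of the counted sets because \<open>card\<close> of an infinite set is 0, which would disturb
  the case \<open>j = 0\<close>.\<close>

lemma card_faces_containing:
  assumes "v \<in> \<Union>K"
  shows "card {\<sigma> \<in> faces K. v \<in> \<sigma> \<and> finite \<sigma> \<and> card \<sigma> = Suc j} =
    card {\<sigma> \<in> faces {\<rho>. v \<notin> \<rho> \<and> insert v \<rho> \<in> K}. finite \<sigma> \<and> card \<sigma> = j}" (is "card ?A = card ?B")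
proof -
  have "bij_betw (insert v) ?B ?A"
  proof (rule bij_betw_byWitness[where f' = "\<lambda>\<sigma>. \<sigma> - {v}"])
    show "(\<lambda>\<sigma>. \<sigma> - {v}) ` ?A \<subseteq> ?B"
    proof safe
      fix \<sigma> assume *: "\<sigma> \<in> faces K" "v \<in> \<sigma>" "finite \<sigma>" "card \<sigma> = Suc j"
      then obtain \<tau> where "\<tau> \<in> K" "\<sigma> \<subseteq> \<tau>" by (auto simp: faces_def)
      then have "insert v (\<tau> - {v}) \<in> K" "\<sigma> - {v} \<subseteq> \<tau> - {v}" using * by (auto simp: insert_absorb)
      then show "\<sigma> - {v} \<in> faces {\<rho>. v \<notin> \<rho> \<and> insert v \<rho> \<in> K}"
        unfolding faces_def by blast
      show "card (\<sigma> - {v}) = j" using * by simp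
    qed auto
    show "insert v ` ?B \<subseteq> ?A"
    proof safe
      fix \<rho> assume *: "\<rho> \<in> faces {\<rho>. v \<notin> \<rho> \<and> insert v \<rho> \<in> K}" "finite \<rho>" "j = card \<rho>"
      then obtain \<rho>' where "v \<notin> \<rho>'" "insert v \<rho>' \<in> K" "\<rho> \<subseteq> \<rho>'" by (auto simp: faces_def)
      then have "v \<notin> \<rho>" "insert v \<rho> \<subseteq> insert v \<rho>'" by blast+
      then show "insert v \<rho> \<in> faces K" "card (insert v \<rho>) = Suc (card \<rho>)"
        using \<open>insert v \<rho>' \<in> K\<close> * unfolding faces_def by auto
    qed
    show "\<forall>\<rho>\<in>?B. insert v \<rho> - {v} = \<rho>"
      unfolding faces_def by blast
  qed (auto simp: insert_absorb)
  then show ?thesis by (simp add: bij_betw_same_card)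
qed

text \<open>The boundary of a simplex on \<open>Suc k\<close> vertices attains the bound. The
  induction follows Pascal's rule: faces through a vertex \<open>v\<close> are counted in its link,
  faces avoiding \<open>v\<close> inside one member that misses \<open>v\<close>.\<close>

lemma core_card_faces:
  assumes "core k K" "finite K" "j \<le> k"
  shows "Suc k choose j \<le> card {\<sigma> \<in> faces K. finite \<sigma> \<and> card \<sigma> = j}"
  using assms
proof (induction k arbitrary: K j)
  case 0
  have "\<tau> = {}" if "\<tau> \<in> K" for \<tau> using coreD(2,3)[OF 0(1) that] by simp
  with coreD(1)[OF 0(1)] have "K = {{}}" by blast
  then have "{\<sigma> \<in> faces K. finite \<sigma> \<and> card \<sigma> = j} = {{}}"
    using 0 by (auto simp: faces_def)
  then show ?case using 0 by simp
next
  case (Suc k)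
  note fin = Suc.prems(2) 
  obtain \<tau> where \<tau>: "\<tau> \<in> K" using coreD(1)[OF Suc.prems(1)] by blast
  then have "card \<tau> = Suc k" "finite \<tau>" using coreD[OF Suc.prems(1)] by auto
  then obtain v where v: "v \<in> \<tau>" by fastforce
  \<comment> \<open>The second member over the facet opposite \<open>v\<close> is the one that
    misses \<open>v\<close>.\<close>
  obtain \<tau>' where \<tau>': "\<tau>' \<in> K" "\<tau>' \<noteq> \<tau>" "\<tau> - {v} \<subseteq> \<tau>'"
    using coreD(4)[OF Suc.prems(1) \<tau> v] by blast
  have c': "card \<tau>' = Suc k" "finite \<tau>'" using coreD[OF Suc.prems(1)] \<tau>' by auto
  have vn: "v \<notin> \<tau>'"
  proof
    assume "v \<in> \<tau>'"
    then have "\<tau> \<subseteq> \<tau>'" using \<tau>' by blast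
    then show False using c' \<open>card \<tau> = Suc k\<close> \<tau>'(2) card_subset_eq[of \<tau>' \<tau>] by simp
  qed
  let ?L = "{\<rho>. v \<notin> \<rho> \<and> insert v \<rho> \<in> K}"
  have ff: "finite (faces K)" using finite_faces fin coreD(2)[OF Suc.prems(1)] by blast
  have coreL: "core k ?L" by (rule core_link[OF Suc.prems(1)]) (use v \<tau> in blast)
  have finL: "finite ?L"
    by (rule finite_subset[of _ "faces K"]) (use ff in \<open>auto simp: faces_def\<close>)
  show ?case
  proof (cases j)
    case 0
    then have "{} \<in> {\<sigma> \<in> faces K. finite \<sigma> \<and> card \<sigma> = j}" using \<tau> by (auto simp: faces_def)
    then have "card {\<sigma> \<in> faces K. finite \<sigma> \<and> card \<sigma> = j} > 0" using ff by (subst card_gt_0_iff) auto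
    then show ?thesis using 0 by simp
  next
    case j: (Suc i)
    let ?A = "{\<sigma> \<in> faces K. v \<in> \<sigma> \<and> finite \<sigma> \<and> card \<sigma> = Suc i}"
    let ?B = "{\<sigma>. \<sigma> \<subseteq> \<tau>' \<and> card \<sigma> = Suc i}"
    have "Suc k choose i \<le> card ?A"
      using Suc.IH[OF coreL finL, of i] card_faces_containing[of v K i] v \<tau> j Suc.prems(3) by fastforce
    moreover have "card ?B = Suc k choose Suc i" using c' by (simp add: n_subsets)
    moreover have "card ?A + card ?B = card (?A \<union> ?B)"
      using vn ff c' by (intro card_Un_disjoint[symmetric]) (auto intro: finite_subset[of _ "Pow \<tau>'"])
    moreover have "card (?A \<union> ?B) \<le> card {\<sigma> \<in> faces K. finite \<sigma> \<and> card \<sigma> = j}"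
    proof (rule card_mono)
      show "?A \<union> ?B \<subseteq> {\<sigma> \<in> faces K. finite \<sigma> \<and> card \<sigma> = j}"
        using \<tau>'(1) j finite_subset[OF _ c'(2)] unfolding faces_def by blast
    qed (use ff in simp)
    ultimately show ?thesis using j by simp
  qed
qed

lemma core_vertex_card_faces:
  assumes "core (Suc k) K" "finite K" "v \<in> \<Union>K" "i \<le> k"
  shows "Suc k choose i \<le> card {\<sigma> \<in> faces K. v \<in> \<sigma> \<and> finite \<sigma> \<and> card \<sigma> = Suc i}"
proof -
  let ?L = "{\<rho>. v \<notin> \<rho> \<and> insert v \<rho> \<in> K}"
  have "finite (faces K)" using finite_faces coreD(2)[OF assms(1)] assms(2) by blast
  then have "finite ?L"
    by (rule rev_finite_subset) (auto simp: faces_def)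
  then show ?thesis
    using core_card_faces[OF core_link[OF assms(1,3)] _ assms(4)] card_faces_containing[OF assms(3)] by metis
qed

text \<open>Double counting of incidences between vertices and faces of each dimension. Equality
  holds for the boundary of a simplex on \<open>d + 2\<close> vertices, whose weight is
  \<open>S2 \<alpha> d\<close>.\<close>

lemma core_weight:
  assumes \<alpha>: "\<forall>i\<ge>1. \<alpha> i \<ge> 0" and K: "core (Suc d) K" "finite K"
  shows "real (card (\<Union>K)) * S2 \<alpha> d \<le> real (d + 2) * weight \<alpha> (faces K)"
proof -
  have finK: "finite \<tau>" if "\<tau> \<in> K" for \<tau> using coreD(2)[OF K(1) that] .
  have fF: "finite (faces K)" using finite_faces K(2) finK by blast
  have fV: "finite (\<Union>K)" using K(2) finK by blast
  let ?f = "\<lambda>i. card {\<sigma> \<in> faces K. card \<sigma> = Suc i}"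
  have le: "card \<sigma> \<le> Suc d" if \<sigma>: "\<sigma> \<in> faces K" for \<sigma>
  proof -
    obtain \<tau> where "\<tau> \<in> K" "\<sigma> \<subseteq> \<tau>" using \<sigma> unfolding faces_def by blast
    then show ?thesis using card_mono[of \<tau> \<sigma>] coreD(2,3)[OF K(1)] by auto
  qed
  have weight: "weight \<alpha> (faces K) = (\<Sum>i=1..d. \<alpha> i * real (?f i))"
    by (rule weight_eq_sum_card[OF fF]) (rule le)
  have count: "card (\<Union>K) * (d + 2 choose (i + 1)) \<le> (d + 2) * ?f i" if "i \<le> d" for i
  proof -
    have "card (\<Union>K) * (Suc d choose i) = (\<Sum>v\<in>\<Union>K. Suc d choose i)" by simp
    also have "\<dots> \<le> (\<Sum>v\<in>\<Union>K. card {\<sigma> \<in> {\<sigma> \<in> faces K. card \<sigma> = Suc i}. v \<in> \<sigma>})"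
    proof (rule sum_mono)
      fix v assume v: "v \<in> \<Union>K"
      have "Suc d choose i \<le> card {\<sigma> \<in> faces K. v \<in> \<sigma> \<and> finite \<sigma> \<and> card \<sigma> = Suc i}"
        by (rule core_vertex_card_faces[OF K v that])
      also have "\<dots> \<le> card {\<sigma> \<in> {\<sigma> \<in> faces K. card \<sigma> = Suc i}. v \<in> \<sigma>}"
        by (rule card_mono) (use fF in auto)
      finally show "Suc d choose i \<le> card {\<sigma> \<in> {\<sigma> \<in> faces K. card \<sigma> = Suc i}. v \<in> \<sigma>}" .
    qed
    also have "\<dots> = Suc i * ?f i"
    proof (rule sum_multicount)
      show "\<forall>\<sigma>\<in>{\<sigma> \<in> faces K. card \<sigma> = Suc i}. card {v \<in> \<Union>K. v \<in> \<sigma>} = Suc i"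
      proof
        fix \<sigma> assume \<sigma>: "\<sigma> \<in> {\<sigma> \<in> faces K. card \<sigma> = Suc i}"
        then have "{v \<in> \<Union>K. v \<in> \<sigma>} = \<sigma>" by (auto simp: faces_def)
        then show "card {v \<in> \<Union>K. v \<in> \<sigma>} = Suc i" using \<sigma> by simp
      qed
    qed (use fV fF in auto)
    finally have "(d + 2) * (card (\<Union>K) * (Suc d choose i)) \<le> (d + 2) * (Suc i * ?f i)"
      by (rule mult_le_mono2)
    \<comment> \<open>The absorption identity turns the count around one vertex into the coefficient
      of \<open>S2\<close>.\<close>
    moreover have "(d + 2) * (Suc d choose i) = Suc i * (d + 2 choose (i + 1))"
      using Suc_times_binomial_eq[of "Suc d" i] by (simp add: mult.commute)
    ultimately have "Suc i * (card (\<Union>K) * (d + 2 choose (i + 1))) \<le> Suc i * ((d + 2) * ?f i)"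
      by (metis mult.left_commute)
    then show ?thesis by (simp only: mult_le_cancel1)
  qed
  have "real (card (\<Union>K)) * S2 \<alpha> d =
      (\<Sum>i=1..d. \<alpha> i * real (card (\<Union>K) * (d + 2 choose (i + 1))))"
    by (simp add: S2_def sum_distrib_left mult_ac)
  also have "\<dots> \<le> (\<Sum>i=1..d. \<alpha> i * real ((d + 2) * ?f i))"
    using \<alpha> count by (intro sum_mono mult_left_mono) (auto simp only: of_nat_le_iff atLeastAtMost_iff)
  also have "\<dots> = real (d + 2) * weight \<alpha> (faces K)"
    unfolding weight sum_distrib_left by (intro sum.cong refl) (simp only: of_nat_mult mult_ac)
  finally show ?thesis .
qed

section \<open>Growing a family vertex by vertex\<close>

lemma weight_Un_disjoint:
  assumes "finite A" "finite B" "A \<inter> B = {}"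
  shows "weight \<alpha> (A \<union> B) = weight \<alpha> A + weight \<alpha> B"
proof -
  have "{\<sigma>. \<sigma> \<in> A \<union> B \<and> card \<sigma> \<ge> 2} = {\<sigma>. \<sigma> \<in> A \<and> card \<sigma> \<ge> 2} \<union> {\<sigma>. \<sigma> \<in> B \<and> card \<sigma> \<ge> 2}"
    by blast
  then show ?thesis
    unfolding weight_def using assms by (simp add: sum.union_disjoint disjoint_iff)
qed

lemma weight_mono:
  assumes "\<forall>i\<ge>1. \<alpha> i \<ge> 0" "finite B" "A \<subseteq> B"
  shows "weight \<alpha> A \<le> weight \<alpha> B"
  unfolding weight_def using assms by (intro sum_mono2) auto

lemma weight_nonneg: "\<forall>i\<ge>1. \<alpha> i \<ge> 0 \<Longrightarrow> weight \<alpha> A \<ge> 0"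
  unfolding weight_def by (intro sum_nonneg) auto

text \<open>The exponent paid for a new vertex joined to a simplex on \<open>k\<close> old vertices:
  \<open>k choose i\<close> of the new faces have dimension \<open>i\<close>.\<close>

definition S1 :: "(nat \<Rightarrow> real) \<Rightarrow> nat \<Rightarrow> real" where
  "S1 \<alpha> k = (\<Sum>i=1..k. real (k choose i) * \<alpha> i)"

lemma weight_cone:
  assumes "finite R" "u \<notin> R"
  shows "weight \<alpha> (insert u ` Pow R) = S1 \<alpha> (card R)"
proof -
  have card_insert: "card (insert u \<rho>) = Suc (card \<rho>)" if "\<rho> \<subseteq> R" for \<rho>
    using that assms finite_subset[of \<rho> R] by (subst card_insert_disjoint) auto
  have le: "card \<sigma> \<le> Suc (card R)" if "\<sigma> \<in> insert u ` Pow R" for \<sigma>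
    using that card_insert card_mono[OF assms(1)] by auto
  have "card {\<sigma> \<in> insert u ` Pow R. card \<sigma> = Suc i} = card R choose i" for i
  proof -
    have "{\<sigma> \<in> insert u ` Pow R. card \<sigma> = Suc i} = insert u ` {\<rho>. \<rho> \<subseteq> R \<and> card \<rho> = i}"
      using card_insert by fastforce
    moreover have "inj_on (insert u) {\<rho>. \<rho> \<subseteq> R \<and> card \<rho> = i}"
      using assms(2) by (intro inj_onI) (metis insert_ident mem_Collect_eq subsetD)
    ultimately show ?thesis using assms(1) by (simp add: card_image n_subsets)
  qed
  then show ?thesis
    using assms(1) by (subst weight_eq_sum_card[OF _ le]) (auto simp: S1_def mult.commute)
qed

text \<open>Transfers the hypothesis on \<open>S2\<close> to growth:
  \<open>S2 \<alpha> d > d + 2\<close> forces \<open>S1 \<alpha> d > 1\<close>. The comparison is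
  made coefficient by coefficient.\<close>

lemma S2_le_S1:
  assumes "\<forall>i\<ge>1. \<alpha> i \<ge> 0"
  shows "S2 \<alpha> d \<le> real (d + 2) * S1 \<alpha> d"
proof -
  have binom: "(d + 2) choose (i + 1) \<le> (d + 2) * (d choose i)" if i: "i \<le> d" for i
  proof -
    have "(d + 1 - i) * (Suc d choose i) = (d + 1) * (d choose i)"
      using binomial_absorb_comp[of "Suc d" i] by simp
    also have "\<dots> \<le> ((i + 1) * (d + 1 - i)) * (d choose i)"
    proof (rule mult_le_mono1)
      \<comment> \<open>In terms of \<open>i\<close> and \<open>j\<close> the claim is
        \<open>i + j + 1 \<le> (i + 1) * (j + 1)\<close>.\<close>
      obtain j where "d = i + j" using i le_Suc_ex by blast
      then show "d + 1 \<le> (i + 1) * (d + 1 - i)" by simp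
    qed
    finally have "(d + 1 - i) * (Suc d choose i) \<le> (d + 1 - i) * ((i + 1) * (d choose i))"
      by (simp only: mult_ac)
    then have "Suc d choose i \<le> (i + 1) * (d choose i)"
      using i by (simp only: mult_le_cancel1)
    then have "(d + 2) * (Suc d choose i) \<le> (d + 2) * ((i + 1) * (d choose i))"
      by (rule mult_le_mono2)
    moreover have "(d + 2) * (Suc d choose i) = (i + 1) * ((d + 2) choose (i + 1))"
      using Suc_times_binomial_eq[of "Suc d" i] by (simp add: mult.commute)
    ultimately have "(i + 1) * ((d + 2) choose (i + 1)) \<le> (i + 1) * ((d + 2) * (d choose i))"
      by (metis mult.left_commute)
    then show ?thesis by (simp only: mult_le_cancel1)
  qed
  have "S2 \<alpha> d \<le> (\<Sum>i=1..d. real ((d + 2) * (d choose i)) * \<alpha> i)"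
    unfolding S2_def using assms binom
    by (intro sum_mono mult_right_mono) (auto simp only: of_nat_le_iff atLeastAtMost_iff)
  also have "\<dots> = real (d + 2) * S1 \<alpha> d"
    unfolding S1_def sum_distrib_left
    by (intro sum.cong refl) (simp only: of_nat_mult mult.assoc)
  finally show ?thesis .
qed

text \<open>Growth starts from a single member, with \<open>Suc d\<close> vertices, and can only be
  blocked by a core on the vertices reached so far. Each step adds one vertex and at least
  \<open>S1 \<alpha> d\<close> to the weight.\<close>

lemma core_grow:
  assumes \<alpha>: "\<forall>i\<ge>1. \<alpha> i \<ge> 0" and K: "core (Suc d) K" "finite K"
  shows "(\<exists>K'\<subseteq>K. core (Suc d) K' \<and> card (\<Union>K') \<le> Suc d + j) \<or>
    (\<exists>G\<subseteq>K. card (\<Union>G) = Suc d + j \<and> real j * S1 \<alpha> d \<le> weight \<alpha> (faces G))"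
proof (induction j)
  case 0
  obtain \<tau> where "\<tau> \<in> K" using coreD(1)[OF K(1)] by blast
  then have "{\<tau>} \<subseteq> K \<and> card (\<Union>{\<tau>}) = Suc d + 0 \<and> real 0 * S1 \<alpha> d \<le> weight \<alpha> (faces {\<tau>})"
    using coreD(3)[OF K(1)] weight_nonneg[OF \<alpha>] by simp
  then show ?case by blast
next
  case (Suc j)
  from Suc.IH show ?case
  proof (elim disjE exE conjE)
    fix K' assume "K' \<subseteq> K" "core (Suc d) K'" "card (\<Union>K') \<le> Suc d + j"
    then show ?thesis by (intro disjI1 exI[of _ K'] conjI) auto
  next
    fix G assume G: "G \<subseteq> K" "card (\<Union>G) = Suc d + j" "real j * S1 \<alpha> d \<le> weight \<alpha> (faces G)"
    \<comment> \<open>Either the members of \<open>K\<close> inside the vertex set of \<open>G\<close> already form a core, or some member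
      of \<open>K\<close> adjacent to one of them has exactly one vertex outside.\<close>
    define K' where "K' = {\<tau> \<in> K. \<tau> \<subseteq> \<Union>G}"
    have UK': "\<Union>K' = \<Union>G" using G(1) unfolding K'_def by blast
    show ?thesis
    proof (cases "core (Suc d) K'")
      case True
      then show ?thesis using UK' G(2) by (intro disjI1 exI[of _ K'] conjI) (auto simp: K'_def)
    next
      case False
      have "K' \<noteq> {}"
      proof
        assume "K' = {}"
        then have "card (\<Union>G) = 0" using UK' by (metis Union_empty card.empty)
        then show False using G(2) by simp
      qed
      moreover have "finite \<tau>" "card \<tau> = Suc d" if "\<tau> \<in> K'" for \<tau>
        using that coreD(2,3)[OF K(1)] by (auto simp: K'_def)
      ultimately obtain \<tau> v where \<tau>: "\<tau> \<in> K'" "v \<in> \<tau>"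
        and no: "\<And>\<tau>'. \<tau>' \<in> K' \<Longrightarrow> \<tau> - {v} \<subseteq> \<tau>' \<Longrightarrow> \<tau>' = \<tau>"
        using False by (metis not_coreE)
      have \<tau>K: "\<tau> \<in> K" "\<tau> \<subseteq> \<Union>G" using \<tau>(1) by (auto simp: K'_def)
      \<comment> \<open>Inside the vertex set of \<open>G\<close> only \<open>\<tau>\<close>
        contains \<open>\<tau> - {v}\<close>, but \<open>K\<close> is a core, so another member does
        so and must leave that vertex set.\<close>
      then obtain \<tau>' where \<tau>': "\<tau>' \<in> K" "\<tau>' \<noteq> \<tau>" "\<tau> - {v} \<subseteq> \<tau>'"
        using coreD(4)[OF K(1) \<tau>K(1) \<tau>(2)] by blast
      define R where "R = \<tau> - {v}"
      have R: "finite R" "card R = d" using coreD(2,3)[OF K(1) \<tau>K(1)] \<tau>(2) by (auto simp: R_def)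
      have "card (\<tau>' - R) = 1"
        using R \<tau>' coreD(2,3)[OF K(1) \<tau>'(1)] by (simp add: R_def[symmetric] card_Diff_subset)
      then obtain u where "\<tau>' - R = {u}" by (rule card_1_singletonE)
      then have u: "\<tau>' = insert u R" "u \<notin> R" using \<tau>'(3) unfolding R_def by blast+
      have uG: "u \<notin> \<Union>G"
      proof
        assume "u \<in> \<Union>G"
        then have "\<tau>' \<in> K'" using u(1) \<tau>K(2) \<tau>'(1) unfolding K'_def R_def by blast
        then show False using no \<tau>'(2,3) by blast
      qed
      have finG: "finite G" "\<And>\<sigma>. \<sigma> \<in> G \<Longrightarrow> finite \<sigma>"
        using G(1) K(2) coreD(2)[OF K(1)] by (auto intro: finite_subset)
      have finF: "finite (faces G)" "finite (faces (insert \<tau>' G))"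
        using finG R u(1) by (auto intro!: finite_faces)
      have "\<Union>(insert \<tau>' G) = insert u (\<Union>G)" using u(1) \<tau>K(2) unfolding R_def by blast
      then have card: "card (\<Union>(insert \<tau>' G)) = Suc d + Suc j" using uG finG G(2) by simp
      have "real (Suc j) * S1 \<alpha> d \<le> weight \<alpha> (faces G) + weight \<alpha> (insert u ` Pow R)"
        using G(3) weight_cone[OF R(1) u(2), of \<alpha>] R(2) by (simp add: algebra_simps)
      \<comment> \<open>All faces in the second family contain \<open>u\<close>, which lies in no
        face of \<open>G\<close>.\<close>
      also have "\<dots> = weight \<alpha> (faces G \<union> insert u ` Pow R)"
        using uG R finF by (intro weight_Un_disjoint[symmetric]) (auto simp: faces_def)
      also have "\<dots> \<le> weight \<alpha> (faces (insert \<tau>' G))"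
        using finF u(1) by (intro weight_mono \<alpha>) (auto simp: faces_def)
      finally show ?thesis using card \<tau>'(1) G(1) by (intro disjI2 exI[of _ "insert \<tau>' G"] conjI) auto
    qed
  qed
qed

text \<open>Weight per vertex stays above 1 by a fixed margin in both outcomes of
  \<open>core_grow\<close>: by \<open>core_weight\<close> for a small core, and by the number of
  growth steps otherwise.\<close>

lemma core_contains_heavy:
  assumes \<alpha>: "\<forall>i\<ge>1. \<alpha> i \<ge> 0" and S2: "S2 \<alpha> d > real d + 2"
  obtains M :: nat and r :: real where "r > 1"
    "\<And>K :: 'a set set. core (Suc d) K \<Longrightarrow> finite K \<Longrightarrow>
       \<exists>G\<subseteq>K. 1 \<le> card (\<Union>G) \<and> card (\<Union>G) \<le> M \<and> r * real (card (\<Union>G)) \<le> weight \<alpha> (faces G)"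
proof -
  have "real (d + 2) < real (d + 2) * S1 \<alpha> d" using S2_le_S1[OF \<alpha>, of d] S2 by linarith
  then have "S1 \<alpha> d > 1" by simp
  \<comment> \<open>The first \<open>Suc d\<close> vertices are credited with no weight. Each later
    one gains \<open>S1 \<alpha> d - 1\<close> over its own cost, so \<open>N\<close> steps make up
    for them.\<close>
  then obtain N :: nat where "real N * (S1 \<alpha> d - 1) > real (Suc d)"
    using reals_Archimedean3[of "S1 \<alpha> d - 1"] by auto
  then have N: "real N * S1 \<alpha> d > real (Suc d + N)" by (simp add: algebra_simps)
  \<comment> \<open>The smaller of the two guaranteed weights per vertex.\<close>
  define r where "r = min (S2 \<alpha> d / real (d + 2)) (real N * S1 \<alpha> d / real (Suc d + N))"
  show ?thesis
  proof (rule that)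
    show "r > 1" using N S2 by (simp add: r_def less_divide_eq)
    fix K :: "'a set set" assume K: "core (Suc d) K" "finite K"
    from core_grow[OF \<alpha> K, where j = N]
    show "\<exists>G\<subseteq>K. 1 \<le> card (\<Union>G) \<and> card (\<Union>G) \<le> Suc d + N \<and> r * real (card (\<Union>G)) \<le> weight \<alpha> (faces G)"
    proof (elim disjE exE conjE)
      fix K' assume K': "K' \<subseteq> K" "core (Suc d) K'" "card (\<Union>K') \<le> Suc d + N"
      have fin: "finite K'" using K'(1) K(2) by (rule finite_subset)
      obtain \<tau> where \<tau>: "\<tau> \<in> K'" using coreD(1)[OF K'(2)] by blast
      have "card \<tau> \<le> card (\<Union>K')"
        using \<tau> fin coreD(2)[OF K'(2)] by (intro card_mono) auto
      then have ge: "1 \<le> card (\<Union>K')" using coreD(3)[OF K'(2) \<tau>] by simp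
      have "r * real (card (\<Union>K')) \<le> S2 \<alpha> d / real (d + 2) * real (card (\<Union>K'))"
        by (intro mult_right_mono) (auto simp: r_def)
      also have "\<dots> \<le> weight \<alpha> (faces K')"
        using core_weight[OF \<alpha> K'(2) fin] by (simp add: divide_le_eq mult.commute)
      finally show ?thesis using K' ge by blast
    next
      fix G assume G: "G \<subseteq> K" "card (\<Union>G) = Suc d + N" "real N * S1 \<alpha> d \<le> weight \<alpha> (faces G)"
      have "0 < real (Suc d + N)" by simp
      then have "r * real (Suc d + N) \<le> real N * S1 \<alpha> d"
        by (subst pos_le_divide_eq[symmetric]) (simp_all only: r_def min.cobounded2)
      then show ?thesis using G by (intro exI[of _ G]) auto
    qed
  qed
qed

section \<open>Collapsing complexes without cores\<close>

definition simplicial_complex :: "'a set set \<Rightarrow> bool" where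
  "simplicial_complex C \<longleftrightarrow>
     finite C \<and> (\<forall>\<sigma>\<in>C. finite \<sigma> \<and> \<sigma> \<noteq> {} \<and> (\<forall>\<rho>. \<rho> \<subseteq> \<sigma> \<longrightarrow> \<rho> \<noteq> {} \<longrightarrow> \<rho> \<in> C))"

lemma simplicial_complexD:
  assumes "simplicial_complex C"
  shows "finite C" "\<And>\<sigma>. \<sigma> \<in> C \<Longrightarrow> finite \<sigma>" "\<And>\<sigma>. \<sigma> \<in> C \<Longrightarrow> \<sigma> \<noteq> {}"
    "\<And>\<sigma> \<rho>. \<sigma> \<in> C \<Longrightarrow> \<rho> \<subseteq> \<sigma> \<Longrightarrow> \<rho> \<noteq> {} \<Longrightarrow> \<rho> \<in> C"
  using assms unfolding simplicial_complex_def by blast+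

text \<open>Only \<open>\<tau>\<close> lies properly above \<open>\<sigma>\<close>, and nothing lies
  properly above \<open>\<tau>\<close>, since it would also lie above \<open>\<sigma>\<close>. So no
  remaining face loses a subface.\<close>

lemma simplicial_complex_collapse:
  assumes C: "simplicial_complex C" and ff: "free_face C \<sigma> \<tau>"
  shows "simplicial_complex (C - {\<sigma>, \<tau>})"
  unfolding simplicial_complex_def
proof (intro conjI ballI allI impI)
  have max: "\<rho> = \<tau>" if "\<rho> \<in> C" "\<sigma> \<subset> \<rho>" for \<rho>
    using ff that unfolding free_face_def by blast
  have lt: "\<sigma> \<subset> \<tau>" using ff unfolding free_face_def by blast
  fix \<mu> assume \<mu>: "\<mu> \<in> C - {\<sigma>, \<tau>}"
  fix \<rho> assume \<rho>: "\<rho> \<subseteq> \<mu>" "\<rho> \<noteq> {}"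
  have "\<rho> \<in> C" using simplicial_complexD(4)[OF C] \<mu> \<rho> by blast
  moreover have "\<rho> \<noteq> \<sigma>" using max[of \<mu>] \<mu> \<rho>(1) by blast
  moreover have "\<rho> \<noteq> \<tau>" using max[of \<mu>] \<mu> \<rho>(1) lt by blast
  ultimately show "\<rho> \<in> C - {\<sigma>, \<tau>}" by blast
qed (use simplicial_complexD(1-3)[OF C] in auto)

text \<open>The second member over \<open>\<tau> - {v}\<close> is \<open>\<rho> - {v}\<close>, the
  facet opposite \<open>v\<close>.\<close>

lemma core_simplex_boundary:
  assumes "finite \<rho>" "card \<rho> = Suc k"
  shows "core k {\<sigma>. \<sigma> \<subseteq> \<rho> \<and> card \<sigma> = k}"
  unfolding core_def
proof (intro conjI ballI)
  obtain v where "v \<in> \<rho>" using assms by fastforce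
  then have "\<rho> - {v} \<in> {\<sigma>. \<sigma> \<subseteq> \<rho> \<and> card \<sigma> = k}" using assms by auto
  then show "{\<sigma>. \<sigma> \<subseteq> \<rho> \<and> card \<sigma> = k} \<noteq> {}" by (metis empty_iff)
next
  fix \<tau> assume \<tau>: "\<tau> \<in> {\<sigma>. \<sigma> \<subseteq> \<rho> \<and> card \<sigma> = k}"
  show "finite \<tau>" "card \<tau> = k" using \<tau> assms finite_subset by auto
  fix v assume "v \<in> \<tau>"
  then have "\<rho> - {v} \<in> {\<sigma>. \<sigma> \<subseteq> \<rho> \<and> card \<sigma> = k}" "\<rho> - {v} \<noteq> \<tau>" "\<tau> - {v} \<subseteq> \<rho> - {v}"
    using \<tau> assms by (auto simp: subsetD)
  then show "\<exists>\<tau>'\<in>{\<sigma>. \<sigma> \<subseteq> \<rho> \<and> card \<sigma> = k}. \<tau>' \<noteq> \<tau> \<and> \<tau> - {v} \<subseteq> \<tau>'"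
    by (intro bexI[of _ "\<rho> - {v}"] conjI)
qed

text \<open>Induction on the number of faces: having no core passes to subcomplexes, and as long as
  a \<open>d\<close>-simplex is left, the failure of the core condition supplies a free
  face.\<close>

lemma collapses_if_no_core:
  assumes "simplicial_complex C" "d \<ge> 1" "\<And>K. K \<subseteq> C \<Longrightarrow> \<not> core (Suc d) K"
  shows "collapses_onto_dim C (int d - 1)"
  using assms
proof (induction "card C" arbitrary: C rule: less_induct)
  case less
  note C = simplicial_complexD[OF less.prems(1)]
  \<comment> \<open>A larger simplex would contain one on \<open>d + 2\<close> vertices, whose
    boundary is a core.\<close>
  have le: "card \<rho> \<le> Suc d" if "\<rho> \<in> C" for \<rho>
  proof (rule ccontr)
    assume "\<not> card \<rho> \<le> Suc d"
    then obtain \<rho>' where \<rho>': "\<rho>' \<subseteq> \<rho>" "card \<rho>' = Suc (Suc d)" "finite \<rho>'"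
      using obtain_subset_with_card_n[of "Suc (Suc d)" \<rho>] by auto
    have "\<sigma> \<in> C" if "\<sigma> \<subseteq> \<rho>'" "card \<sigma> = Suc d" for \<sigma>
    proof (rule C(4)[OF \<open>\<rho> \<in> C\<close>])
      show "\<sigma> \<subseteq> \<rho>" using that(1) \<rho>'(1) by (rule order_trans)
      show "\<sigma> \<noteq> {}" using that(2) by auto
    qed
    then have "{\<sigma>. \<sigma> \<subseteq> \<rho>' \<and> card \<sigma> = Suc d} \<subseteq> C" by blast
    then show False using less.prems(3) core_simplex_boundary[OF \<rho>'(3,2)] by blast
  qed
  let ?K = "{\<tau> \<in> C. card \<tau> = Suc d}"
  show ?case
  proof (cases "?K = {}")
    case True
    have "simplex_dim \<sigma> \<le> int d - 1" if "\<sigma> \<in> C" for \<sigma>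
      using True le[OF that] that by (force simp: simplex_dim_def)
    then show ?thesis unfolding collapses_onto_dim_def by blast
  next
    case False
    have "\<not> core (Suc d) ?K" by (rule less.prems(3)) auto
    then obtain \<tau> v where \<tau>: "\<tau> \<in> ?K" "v \<in> \<tau>"
      and no: "\<And>\<tau>'. \<tau>' \<in> ?K \<Longrightarrow> \<tau> - {v} \<subseteq> \<tau>' \<Longrightarrow> \<tau>' = \<tau>"
      by (rule not_coreE) (use False C(2) in auto)
    then have \<tau>: "\<tau> \<in> C" "card \<tau> = Suc d" "v \<in> \<tau>" by auto
    have c: "card (\<tau> - {v}) = d" using \<tau> by simp
    have ff: "free_face C (\<tau> - {v}) \<tau>"
      unfolding free_face_def
    proof (intro conjI ballI impI)
      \<comment> \<open>Here \<open>d \<ge> 1\<close> ensures that the facet is nonempty and hence a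
        face of \<open>C\<close>.\<close>
      show "\<tau> - {v} \<in> C" using C(4)[OF \<tau>(1), of "\<tau> - {v}"] c less.prems(2) by (metis Diff_subset card.empty not_one_le_zero)
      show "simplex_dim \<tau> = simplex_dim (\<tau> - {v}) + 1" using c \<tau>(2) by (simp add: simplex_dim_def)
      fix \<rho> assume \<rho>: "\<rho> \<in> C" "\<tau> - {v} \<subset> \<rho>"
      \<comment> \<open>Together with \<open>le\<close> this makes \<open>\<rho>\<close> a member of
        \<open>?K\<close>, so \<open>no\<close> applies.\<close>
      have "card \<rho> > d" using psubset_card_mono[OF C(2)[OF \<rho>(1)] \<rho>(2)] c by simp
      then show "\<rho> = \<tau>" using no[of \<rho>] \<rho> le[OF \<rho>(1)] by auto
    qed (use \<tau> in auto)
    let ?C = "C - {\<tau> - {v}, \<tau>}"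
    have "card ?C < card C" using C(1) \<tau>(1) by (intro psubset_card_mono) auto
    moreover have "\<not> core (Suc d) K" if "K \<subseteq> ?C" for K
      using that by (intro less.prems(3)) auto
    ultimately have "collapses_onto_dim ?C (int d - 1)"
      using less.hyps simplicial_complex_collapse[OF less.prems(1) ff] less.prems(2) by blast
    moreover have "elementary_collapse C ?C" unfolding elementary_collapse_def using ff by blast
    ultimately show ?thesis
      unfolding collapses_onto_dim_def by (meson converse_rtranclp_into_rtranclp)
  qed
qed

section \<open>Probability estimates in the lower model\<close>

lemma simplicial_complex_lower_complex: "simplicial_complex (lower_complex n H)"
  unfolding simplicial_complex_def
proof (intro conjI ballI allI impI)
  show "finite (lower_complex n H)"
    by (rule finite_subset[of _ "Pow {1..n}"]) (auto simp: lower_complex_def)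
qed (auto simp: lower_complex_def intro: finite_subset)

text \<open>Containing \<open>K\<close> forces every face of \<open>K\<close> with at least two
  vertices to be chosen, and these choices are independent. In general this is only an upper bound:
  if \<open>K\<close> contains the empty set, the probability is 0.\<close>

lemma prob_lower_model_contains:
  assumes \<alpha>: "\<forall>i\<ge>1. \<alpha> i \<ge> 0" and n: "n \<ge> 1" and K: "K \<subseteq> Pow {1..n}"
  shows "measure_pmf.prob (lower_model n (\<lambda>i. real n powr (- \<alpha> i))) {C. K \<subseteq> C}
    \<le> real n powr (- weight \<alpha> (faces K))"
proof -
  let ?p = "\<lambda>\<sigma>. bernoulli_pmf (real n powr (- \<alpha> (card \<sigma> - 1)))"
  let ?P = "Pi_pmf (hyperedges n) False ?p"
  let ?E = "{\<sigma>. \<sigma> \<in> faces K \<and> card \<sigma> \<ge> 2}"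
  \<comment> \<open>The forcing event as a product set: unforced hyperedges contribute a factor
    1.\<close>
  let ?B = "\<lambda>\<sigma>. if \<sigma> \<in> ?E then {True} else UNIV"
  have fin: "finite (hyperedges n)"
    by (rule finite_subset[of _ "Pow {1..n}"]) (auto simp: hyperedges_def)
  have E: "?E \<subseteq> hyperedges n" using K by (auto simp: hyperedges_def faces_def)
  \<comment> \<open>\<open>bernoulli_pmf\<close> clamps its parameter to the unit interval, so this
    bound is what makes the factors equal to the stated powers.\<close>
  have p1: "real n powr (- \<alpha> (card \<sigma> - 1)) \<le> 1" if "\<sigma> \<in> ?E" for \<sigma>
    using that n \<alpha>[rule_format, of "card \<sigma> - 1"] powr_mono[of "- \<alpha> (card \<sigma> - 1)" 0 "real n"] by auto
  have "measure_pmf.prob (lower_model n (\<lambda>i. real n powr (- \<alpha> i))) {C. K \<subseteq> C} =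
      measure_pmf.prob ?P {f. K \<subseteq> lower_complex n {\<sigma> \<in> hyperedges n. f \<sigma>}}"
    by (simp add: lower_model_def random_hypergraph_def vimage_def)
  also have "\<dots> \<le> measure_pmf.prob ?P (Pi (hyperedges n) ?B)"
  proof (rule measure_pmf.finite_measure_mono)
    show "{f. K \<subseteq> lower_complex n {\<sigma> \<in> hyperedges n. f \<sigma>}} \<subseteq> Pi (hyperedges n) ?B"
    proof (intro subsetI Pi_I)
      fix f \<sigma>
      assume f: "f \<in> {f. K \<subseteq> lower_complex n {\<sigma> \<in> hyperedges n. f \<sigma>}}"
      have "f \<sigma>" if "\<sigma> \<in> ?E"
      proof -
        from that obtain \<tau> where \<tau>: "\<tau> \<in> K" "\<sigma> \<subseteq> \<tau>" "card \<sigma> \<ge> 2" by (auto simp: faces_def)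
        then have "\<tau> \<in> lower_complex n {\<sigma> \<in> hyperedges n. f \<sigma>}" using f by blast
        then show ?thesis using \<tau> by (simp add: lower_complex_def)
      qed
      then show "f \<sigma> \<in> ?B \<sigma>" by simp
    qed
  qed simp
  also have "\<dots> = (\<Prod>\<sigma>\<in>hyperedges n. measure_pmf.prob (?p \<sigma>) (?B \<sigma>))"
    by (rule measure_Pi_pmf_Pi[OF fin])
  also have "\<dots> = (\<Prod>\<sigma>\<in>?E. measure_pmf.prob (?p \<sigma>) {True})"
    using fin E by (intro prod.mono_neutral_cong_right) auto
  also have "\<dots> = (\<Prod>\<sigma>\<in>?E. real n powr (- \<alpha> (card \<sigma> - 1)))"
    using p1 by (intro prod.cong) (auto simp: measure_pmf_single)
  also have "\<dots> = real n powr (- weight \<alpha> (faces K))"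
    unfolding weight_def using n by (subst powr_sum[symmetric]) (auto simp: sum_negf)
  finally show ?thesis .
qed

text \<open>Union bound: at most \<open>n ^ m\<close> vertex sets, at most \<open>2 ^ 2 ^ m\<close>
  families on each, and probability at most \<open>n powr (- (r * m))\<close> per family. The double
  exponential is harmless for bounded \<open>m\<close>.\<close>

lemma prob_lower_model_heavy:
  assumes \<alpha>: "\<forall>i\<ge>1. \<alpha> i \<ge> 0" and n: "n \<ge> 1"
  shows "measure_pmf.prob (lower_model n (\<lambda>i. real n powr (- \<alpha> i)))
      {C. \<exists>K\<subseteq>C. card (\<Union>K) = m \<and> r * real m \<le> weight \<alpha> (faces K)}
    \<le> 2 ^ 2 ^ m * real n powr (- ((r - 1) * real m))" (is "measure_pmf.prob ?M ?A \<le> _")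
proof -
  define KK where
    "KK = {K. K \<subseteq> Pow {1..n} \<and> card (\<Union>K) = m \<and> r * real m \<le> weight \<alpha> (faces K)}"
  define WW where "WW = {W. W \<subseteq> {1..n} \<and> card W = m}"
  have finW: "finite WW" by (simp add: WW_def)
  have KW: "KK \<subseteq> (\<Union>W\<in>WW. Pow (Pow W))"
  proof
    fix K assume "K \<in> KK"
    then have "\<Union>K \<in> WW" by (auto simp: KK_def WW_def)
    then show "K \<in> (\<Union>W\<in>WW. Pow (Pow W))" by (rule UN_I) blast
  qed
  have finU: "finite (\<Union>W\<in>WW. Pow (Pow W))"
    using finW by (auto simp: WW_def intro: finite_subset)
  then have finK: "finite KK" using KW by (rule rev_finite_subset)
  have "card KK \<le> card (\<Union>W\<in>WW. Pow (Pow W))" using finU KW by (rule card_mono)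
  also have "\<dots> \<le> (\<Sum>W\<in>WW. card (Pow (Pow W)))" by (rule card_UN_le[OF finW])
  also have "\<dots> = (\<Sum>W\<in>WW. 2 ^ 2 ^ m)"
  proof (rule sum.cong)
    fix W assume "W \<in> WW"
    then show "card (Pow (Pow W)) = 2 ^ 2 ^ m"
      using finite_subset[of W "{1..n}"] by (simp add: WW_def card_Pow)
  qed simp
  also have "\<dots> = (n choose m) * 2 ^ 2 ^ m" by (simp add: WW_def n_subsets)
  also have "\<dots> \<le> n ^ m * 2 ^ 2 ^ m"
    by (cases "m \<le> n") (auto simp: binomial_le_pow binomial_eq_0)
  finally have "real (card KK) \<le> real (n ^ m * 2 ^ 2 ^ m)" by (rule of_nat_mono)
  also have "\<dots> = 2 ^ 2 ^ m * real n powr real m"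
    using n by (simp only: of_nat_mult of_nat_power of_nat_numeral) (simp add: powr_realpow)
  finally have cardK: "real (card KK) \<le> 2 ^ 2 ^ m * real n powr real m" .
  \<comment> \<open>Restricting to the support ensures that every family considered lives on
    \<open>{1..n}\<close>, so that \<open>KK\<close> covers the event.\<close>
  have "measure_pmf.prob ?M ?A = measure_pmf.prob ?M (?A \<inter> set_pmf ?M)"
    by (simp add: measure_Int_set_pmf)
  also have "\<dots> \<le> measure_pmf.prob ?M (\<Union>K\<in>KK. {C. K \<subseteq> C})"
  proof (rule measure_pmf.finite_measure_mono)
    have supp: "C \<subseteq> Pow {1..n}" if "C \<in> set_pmf ?M" for C
      using that by (auto simp: lower_model_def lower_complex_def)
    show "?A \<inter> set_pmf ?M \<subseteq> (\<Union>K\<in>KK. {C. K \<subseteq> C})"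
    proof
      fix C assume C: "C \<in> ?A \<inter> set_pmf ?M"
      then obtain K where K: "K \<subseteq> C" "card (\<Union>K) = m" "r * real m \<le> weight \<alpha> (faces K)"
        by auto
      have "K \<in> KK" using K supp[of C] C unfolding KK_def by simp
      then show "C \<in> (\<Union>K\<in>KK. {C. K \<subseteq> C})" by (rule UN_I) (simp add: K(1))
    qed
  qed simp
  also have "\<dots> \<le> (\<Sum>K\<in>KK. measure_pmf.prob ?M {C. K \<subseteq> C})"
    using finK by (intro measure_pmf.finite_measure_subadditive_finite) auto
  also have "\<dots> \<le> (\<Sum>K\<in>KK. real n powr (- (r * real m)))"
  proof (rule sum_mono)
    fix K assume "K \<in> KK"
    then have K: "K \<subseteq> Pow {1..n}" "r * real m \<le> weight \<alpha> (faces K)" by (auto simp: KK_def)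
    show "measure_pmf.prob ?M {C. K \<subseteq> C} \<le> real n powr (- (r * real m))"
      using prob_lower_model_contains[OF \<alpha> n K(1)]
      by (rule order_trans) (use n K(2) in \<open>auto intro!: powr_mono\<close>)
  qed
  also have "\<dots> = real (card KK) * real n powr (- (r * real m))" by simp
  also have "\<dots> \<le> (2 ^ 2 ^ m * real n powr real m) * real n powr (- (r * real m))"
    using cardK by (rule mult_right_mono) simp
  also have "\<dots> = 2 ^ 2 ^ m * real n powr (- ((r - 1) * real m))"
    by (simp add: mult.assoc flip: powr_add) (simp add: algebra_simps)
  finally show ?thesis .
qed

section \<open>Passage to the limit\<close>

theorem theorem1p5:
  fixes \<alpha> :: "nat \<Rightarrow> real" and d :: nat
  assumes "\<And>i. i \<ge> 1 \<Longrightarrow> \<alpha> i \<ge> 0"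
    and "\<exists>k. S2 \<alpha> k > real k + 2"
    and "d = (LEAST k. S2 \<alpha> k > real k + 2)"
  shows "(\<lambda>n. measure_pmf.prob (lower_model n (\<lambda>i. real n powr (- \<alpha> i)))
            {C. collapses_onto_dim C (int d - 1)}) \<longlonglongrightarrow> 1"
proof -
  have \<alpha>: "\<forall>i\<ge>1. \<alpha> i \<ge> 0" using assms(1) by blast
  have S2d: "S2 \<alpha> d > real d + 2"
    unfolding assms(3) by (rule LeastI_ex[OF assms(2)])
  \<comment> \<open>\<open>S2 \<alpha> 0\<close> is an empty sum, which does not exceed 2.\<close>
  have d: "d \<ge> 1"
  proof (rule ccontr)
    assume "\<not> d \<ge> 1"
    then show False using S2d by (simp add: S2_def)
  qed
  obtain M :: nat and r :: real where r: "r > 1"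
    and heavy: "\<And>K :: nat set set. core (Suc d) K \<Longrightarrow> finite K \<Longrightarrow>
      \<exists>G\<subseteq>K. 1 \<le> card (\<Union>G) \<and> card (\<Union>G) \<le> M \<and> r * real (card (\<Union>G)) \<le> weight \<alpha> (faces G)"
    using core_contains_heavy[OF \<alpha> S2d] by metis
  let ?M = "\<lambda>n. lower_model n (\<lambda>i. real n powr (- \<alpha> i))"
  let ?good = "{C. collapses_onto_dim C (int d - 1)}"
  let ?A = "\<lambda>m. {C. \<exists>K\<subseteq>C. card (\<Union>K) = m \<and> r * real m \<le> weight \<alpha> (faces K)}"
  let ?b = "\<lambda>n. \<Sum>m=1..M. 2 ^ 2 ^ m * real n powr (- ((r - 1) * real m))"
  have bound: "1 - ?b n \<le> measure_pmf.prob (?M n) ?good" if n: "n \<ge> 1" for n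
  proof -
    have "1 - measure_pmf.prob (?M n) ?good = measure_pmf.prob (?M n) (- ?good)"
      using measure_pmf.prob_compl[of ?good "?M n"] by (simp add: Compl_eq_Diff_UNIV)
    also have "\<dots> = measure_pmf.prob (?M n) (- ?good \<inter> set_pmf (?M n))"
      by (simp add: measure_Int_set_pmf)
    \<comment> \<open>A complex that does not collapse contains a core, hence a heavy family on
      between 1 and \<open>M\<close> vertices.\<close>
    also have "\<dots> \<le> measure_pmf.prob (?M n) (\<Union>m\<in>{1..M}. ?A m)"
    proof (rule measure_pmf.finite_measure_mono; (intro subsetI)?)
      fix C assume C: "C \<in> - ?good \<inter> set_pmf (?M n)"
      then have cplx: "simplicial_complex C"
        using simplicial_complex_lower_complex by (auto simp: lower_model_def)
      then obtain K where K: "K \<subseteq> C" "core (Suc d) K"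
        using collapses_if_no_core[OF cplx d] C by blast
      then have "finite K" using simplicial_complexD(1)[OF cplx] finite_subset by blast
      from heavy[OF K(2) this] obtain G where G: "G \<subseteq> K" "1 \<le> card (\<Union>G)" "card (\<Union>G) \<le> M"
        "r * real (card (\<Union>G)) \<le> weight \<alpha> (faces G)" by blast
      then have "C \<in> ?A (card (\<Union>G))" using K(1) by blast
      then show "C \<in> (\<Union>m\<in>{1..M}. ?A m)" using G(2,3) by (intro UN_I[of "card (\<Union>G)"]) auto
    qed simp
    also have "\<dots> \<le> (\<Sum>m=1..M. measure_pmf.prob (?M n) (?A m))"
      by (intro measure_pmf.finite_measure_subadditive_finite) auto
    also have "\<dots> \<le> ?b n"
      by (intro sum_mono prob_lower_model_heavy \<alpha> n)
    finally show ?thesis by simp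
  qed
  \<comment> \<open>\<open>M\<close> does not depend on \<open>n\<close>, so the limit may be taken
    termwise; each exponent is negative because \<open>r > 1\<close> and
    \<open>m \<ge> 1\<close>.\<close>
  have "?b \<longlonglongrightarrow> (\<Sum>m=1..M. 2 ^ 2 ^ m * 0)"
  proof (intro tendsto_sum tendsto_mult tendsto_const)
    fix m assume "m \<in> {1..M}"
    then show "(\<lambda>n. real n powr (- ((r - 1) * real m))) \<longlonglongrightarrow> 0"
      using r by (intro tendsto_neg_powr filterlim_real_sequentially) auto
  qed
  then have "(\<lambda>n. 1 - ?b n) \<longlonglongrightarrow> 1 - 0"
    by (intro tendsto_diff tendsto_const) simp
  then have lim: "(\<lambda>n. 1 - ?b n) \<longlonglongrightarrow> 1" by simp
  show ?thesis
  proof (rule tendsto_sandwich[OF _ _ lim tendsto_const])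
    show "\<forall>\<^sub>F n in sequentially. 1 - ?b n \<le> measure_pmf.prob (?M n) ?good"
      using bound by (auto intro: eventually_sequentiallyI[of 1])
  qed simp
qed

end
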